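(* If $v\colon \widehat{X}\to X$ is a deformation retraction, then for every $f\colon X\to Y$ we have $\mathrm{TC}(f)=\mathrm{TC}(fv)$, where $fv=f\circ v\colon\widehat X\to Y$.
   Context: All spaces are path-connected metric absolute neighbourhood retracts and $f$ is a continuous surjection. A deformation retraction $v\colon\widehat X\to X$ onto a subspace $i\colon X\hookrightarrow\widehat X$ is a continuous map with $vi=1_X$ and $iv\simeq 1_{\widehat X}$. Let $I=[0,1]$ and let $X^I$ be the space of continuous paths in $X$ with the compact-open topology. For a continuous surjection $p\colon E\to B$, the sectional number $\mathrm{sec}(p)$ is the minimal integer $n$ for which there is an increasing sequence of open subsets $\emptyset=U_0\subseteq U_1\subseteq\cdots\subseteq U_n=B$ such that for each $i=1,\dots,n$ there is a continuous map $s\colon U_i-U_{i-1}\to E$ with $p(s(b))=b$ for all $b$; if no such $n$ exists, $\mathrm{sec}(p)=\infty$. For a continuous surjection $f\colon X\to Y$ between path-connected spaces, $\mathrm{TC}(f)=\mathrm{sec}(\pi_f)$, where $\pi_f\colon X^I\to X\times Y$, $\pi_f(\alpha)=(\alpha(0),f(\alpha(1)))$. *)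

theory Defs
  imports "HOL-Analysis.Analysis" "HOL-Library.Extended_Nat"
begin

text \<open>
  Metric spaces enter only through their topology, so a space is an abstract topology that is
  metrizable.

  An absolute neighbourhood retract is a neighbourhood retract of every metrizable space that
  contains a closed copy of it. HOL cannot quantify over all types inside a definition, so the
  ambient spaces range over all metrizable topologies on \<^typ>\<open>'a \<Rightarrow> real\<close>. This loses
  nothing: by Kuratowski--Wojdyslawski, a metrizable space \<open>X\<close> on \<^typ>\<open>'a\<close> embeds as a closed
  subset of a convex set of bounded real functions on \<open>X\<close>, which is an absolute extensor for
  metrizable spaces by Dugundji's theorem; if \<open>X\<close> is a neighbourhood retract of that convex set,
  it is one of every metrizable space containing it as a closed subset.
\<close>

definition metric_ANR :: "'a topology \<Rightarrow> bool" where
  "metric_ANR X \<longleftrightarrow> metrizable_space X \<and>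
     (\<forall>(Z :: ('a \<Rightarrow> real) topology) C.
        metrizable_space Z \<longrightarrow> closedin Z C \<longrightarrow> X homeomorphic_space subtopology Z C \<longrightarrow>
        (\<exists>V. openin Z V \<and> C \<subseteq> V \<and> C retract_of_space (subtopology Z V)))"

definition deformation_retraction :: "'a topology \<Rightarrow> 'a set \<Rightarrow> ('a \<Rightarrow> 'a) \<Rightarrow> bool" where
  "deformation_retraction Xh S v \<longleftrightarrow>
     S \<subseteq> topspace Xh \<and>
     continuous_map Xh (subtopology Xh S) v \<and>
     (\<forall>x\<in>S. v x = x) \<and>
     homotopic_with (\<lambda>_. True) Xh Xh v id"

text \<open>
  The points of a function space are extensional (equal to \<^term>\<open>undefined\<close> outside the
  domain), so that each continuous map is represented exactly once.
\<close>

definition continuous_maps :: "'a topology \<Rightarrow> 'b topology \<Rightarrow> ('a \<Rightarrow> 'b) set" where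
  "continuous_maps X Y = {h \<in> extensional (topspace X). continuous_map X Y h}"

definition compact_open_topology :: "'a topology \<Rightarrow> 'b topology \<Rightarrow> ('a \<Rightarrow> 'b) topology" where
  "compact_open_topology X Y =
     topology_generated_by
       {{h \<in> continuous_maps X Y. h ` K \<subseteq> U} | K U. compactin X K \<and> openin Y U}"

lemma topspace_compact_open_topology:
  "topspace (compact_open_topology X Y) = continuous_maps X Y"
proof -
  have "continuous_maps X Y
      \<in> {{h \<in> continuous_maps X Y. h ` K \<subseteq> U} | K U. compactin X K \<and> openin Y U}"
    by (auto intro!: exI[of _ "{}"])
  then show ?thesis
    unfolding compact_open_topology_def topology_generated_by_topspace by blast
qed

definition path_space :: "'a topology \<Rightarrow> (real \<Rightarrow> 'a) topology" where
  "path_space X = compact_open_topology (top_of_set {0..1}) X"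

definition sec_filtration ::
  "'e topology \<Rightarrow> 'b topology \<Rightarrow> ('e \<Rightarrow> 'b) \<Rightarrow> nat \<Rightarrow> (nat \<Rightarrow> 'b set) \<Rightarrow> bool" where
  "sec_filtration E B p n U \<longleftrightarrow>
     U 0 = {} \<and> U n = topspace B \<and>
     (\<forall>i\<le>n. openin B (U i)) \<and>
     (\<forall>i\<in>{1..n}. U (i - 1) \<subseteq> U i) \<and>
     (\<forall>i\<in>{1..n}. \<exists>s. continuous_map (subtopology B (U i - U (i - 1))) E s \<and>
                    (\<forall>b \<in> U i - U (i - 1). p (s b) = b))"

text \<open>The infimum of the empty set in \<^typ>\<open>enat\<close> is \<open>\<infinity>\<close>.\<close>

definition sec :: "'e topology \<Rightarrow> 'b topology \<Rightarrow> ('e \<Rightarrow> 'b) \<Rightarrow> enat" where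
  "sec E B p = Inf {enat n | n. \<exists>U. sec_filtration E B p n U}"

definition TC :: "'a topology \<Rightarrow> 'b topology \<Rightarrow> ('a \<Rightarrow> 'b) \<Rightarrow> enat" where
  "TC X Y f = sec (path_space X) (prod_topology X Y) (\<lambda>\<alpha>. (\<alpha> 0, f (\<alpha> 1)))"

end

theory Submission
  imports Defs
begin

text \<open>
  Write \<open>X\<close> for the subspace on \<open>S\<close>. A local section \<open>s\<close> of \<open>\<pi>\<^bsub>fv\<^esub>\<close> over \<open>A\<close> yields the
  local section \<open>(x, y) \<mapsto> v \<circ> s(x, y)\<close> of \<open>\<pi>\<^bsub>f\<^esub>\<close> over the trace of \<open>A\<close> on \<open>X \<times> Y\<close>, as \<open>v\<close> fixes
  \<open>X\<close> pointwise. Conversely, a local section \<open>s\<close> of \<open>\<pi>\<^bsub>f\<^esub>\<close> over \<open>A\<close> yields one of \<open>\<pi>\<^bsub>fv\<^esub>\<close> over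
  the preimage of \<open>A\<close> under \<open>v \<times> 1\<close>: follow the track of the homotopy from \<open>x\<close> to \<open>v x\<close>, and then
  \<open>s(v x, y)\<close>. Filtrations are pulled back along the inclusion and along \<open>v \<times> 1\<close>.
\<close>

section \<open>The exponential law for the compact-open topology\<close>

text \<open>By the tube lemma: if \<open>h w\<close> maps a compact \<open>K\<close> into an open
  \<open>U\<close>, then the open preimage of \<open>U\<close> contains \<open>N \<times> K\<close>
  for some neighbourhood \<open>N\<close> of \<open>w\<close>, so every nearby map also sends
  \<open>K\<close> into \<open>U\<close>.\<close>

lemma continuous_map_compact_open_curry:
  assumes h: "continuous_map (prod_topology W J) X (\<lambda>(w, t). h w t)"
  shows "continuous_map W (compact_open_topology J X) (\<lambda>w. restrict (h w) (topspace J))"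
proof -
  let ?r = "\<lambda>w. restrict (h w) (topspace J)"
  have "continuous_map J X (h w)" if "w \<in> topspace W" for w
    using continuous_map_compose [OF _ h, of J "Pair w"] that
    by (simp add: o_def continuous_map_pairwise)
  then have maps: "?r w \<in> continuous_maps J X" if "w \<in> topspace W" for w
    using that by (auto simp: continuous_maps_def intro: continuous_map_eq)
  show ?thesis
    unfolding compact_open_topology_def
  proof (rule continuous_on_generated_topo)
    fix A
    assume "A \<in> {{h \<in> continuous_maps J X. h ` K \<subseteq> U} | K U. compactin J K \<and> openin X U}"
    then obtain K U where A: "A = {h \<in> continuous_maps J X. h ` K \<subseteq> U}"
      and K: "compactin J K" and U: "openin X U"
      by blast
    have KJ: "K \<subseteq> topspace J"
      by (rule compactin_subset_topspace [OF K])
    let ?P = "{z \<in> topspace (prod_topology W J). (case z of (w, t) \<Rightarrow> h w t) \<in> U}"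
    have P: "openin (prod_topology W J) ?P"
      using openin_continuous_map_preimage [OF h U] .
    show "openin W (?r -` A \<inter> topspace W)"
    proof (subst openin_subopen, intro ballI)
      fix w
      assume w: "w \<in> ?r -` A \<inter> topspace W"
      then have wW: "w \<in> topspace W" and "?r w ` K \<subseteq> U"
        by (auto simp: A)
      then have "h w t \<in> U" if "t \<in> K" for t
        using KJ that by (metis image_subset_iff restrict_apply' subsetD)
      then have "{w} \<times> K \<subseteq> ?P"
        using KJ wW by auto
      from tube_lemma_right [OF P K wW this]
      obtain N V where N: "openin W N" "w \<in> N" and KV: "K \<subseteq> V" and NV: "N \<times> V \<subseteq> ?P"
        by (elim exE conjE)
      have "h n t \<in> U" if "n \<in> N" "t \<in> K" for n t
        using subsetD [OF NV, of "(n, t)"] subsetD [OF KV] that by simp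
      then have "?r n ` K \<subseteq> U" if "n \<in> N" for n
        using KJ that by auto
      then have "N \<subseteq> ?r -` A \<inter> topspace W"
        using maps openin_subset [OF N(1)] by (simp only: A) blast
      with N show "\<exists>T. openin W T \<and> w \<in> T \<and> T \<subseteq> ?r -` A \<inter> topspace W"
        by blast
    qed
  next
    \<comment> \<open>The union of the subbasis is the carrier of the compact-open topology, so this
      is just \<open>maps\<close>.\<close>
    show "?r ` topspace W
        \<subseteq> \<Union> {{h \<in> continuous_maps J X. h ` K \<subseteq> U} | K U. compactin J K \<and> openin X U}"
      using maps
      unfolding topology_generated_by_topspace [symmetric] compact_open_topology_def [symmetric]
        topspace_compact_open_topology
      by blast
  qed
qed

text \<open>Around \<open>t\<close> there is a compact neighbourhood \<open>K\<close> that
  \<open>g w\<close> maps into \<open>U\<close>. Points near \<open>w\<close> give maps in the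
  subbasic set of \<open>K\<close> and \<open>U\<close>, and these send all of \<open>K\<close> into
  \<open>U\<close>.\<close>

lemma continuous_map_compact_open_eval:
  assumes "locally_compact_space J" "Hausdorff_space J"
    and g: "continuous_map W (compact_open_topology J X) g"
  shows "continuous_map (prod_topology W J) X (\<lambda>(w, t). g w t)"
proof -
  \<comment> \<open>The Hausdorff condition upgrades local compactness to arbitrarily small compact
    neighbourhoods.\<close>
  have nb: "neighbourhood_base_of (compactin J) J"
    using assms locally_compact_space_neighbourhood_base by blast
  have maps: "g w \<in> continuous_maps J X" if "w \<in> topspace W" for w
    using continuous_map_funspace [OF g] that by (auto simp: topspace_compact_open_topology)
  then have gJ: "continuous_map J X (g w)" if "w \<in> topspace W" for w
    using that by (auto simp: continuous_maps_def)
  show ?thesis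
    unfolding continuous_map
  proof (intro conjI allI impI)
    show "(\<lambda>(w, t). g w t) ` topspace (prod_topology W J) \<subseteq> topspace X"
      using continuous_map_funspace [OF gJ] by fastforce
  next
    fix U
    assume U: "openin X U"
    let ?P = "{z \<in> topspace (prod_topology W J). (case z of (w, t) \<Rightarrow> g w t) \<in> U}"
    show "openin (prod_topology W J) ?P"
    proof (subst openin_subopen, intro ballI)
      fix z
      assume "z \<in> ?P"
      then obtain w t where z: "z = (w, t)" and w: "w \<in> topspace W" and t: "t \<in> topspace J"
        and wt: "g w t \<in> U"
        by auto
      have "openin J {t \<in> topspace J. g w t \<in> U}"
        by (rule openin_continuous_map_preimage [OF gJ [OF w] U])
      then have "\<exists>V K. openin J V \<and> compactin J K \<and> t \<in> V \<and> V \<subseteq> K \<and> K \<subseteq> {t \<in> topspace J. g w t \<in> U}"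
        using t wt by (intro nb [unfolded neighbourhood_base_of, rule_format]) simp
      then obtain V K where V: "openin J V" "t \<in> V" "V \<subseteq> K" and K: "compactin J K"
        and KU: "K \<subseteq> {t \<in> topspace J. g w t \<in> U}"
        by blast
      let ?N = "{w \<in> topspace W. g w \<in> {h \<in> continuous_maps J X. h ` K \<subseteq> U}}"
      have "openin (compact_open_topology J X) {h \<in> continuous_maps J X. h ` K \<subseteq> U}"
        unfolding compact_open_topology_def using K U
        by (intro topology_generated_by_Basis) blast
      then have "openin W ?N"
        by (rule openin_continuous_map_preimage [OF g])
      then have "openin (prod_topology W J) (?N \<times> V)"
        using V by (simp add: openin_prod_Times_iff)
      moreover have "z \<in> ?N \<times> V"
        using z w V KU maps by auto
      moreover have "?N \<times> V \<subseteq> ?P"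
        using V openin_subset [OF V(1)] by auto
      ultimately show "\<exists>T. openin (prod_topology W J) T \<and> z \<in> T \<and> T \<subseteq> ?P"
        by blast
    qed
  qed
qed

section \<open>Continuous operations on paths\<close>

lemma continuous_map_path_space_curry:
  assumes "continuous_map (prod_topology W (top_of_set {0..1})) X (\<lambda>(w, t). h w t)"
  shows "continuous_map W (path_space X) (\<lambda>w. restrict (h w) {0..1})"
  using continuous_map_compact_open_curry [OF assms] by (simp add: path_space_def)

lemma continuous_map_path_space_eval:
  assumes "continuous_map W (path_space X) g"
  shows "continuous_map (prod_topology W (top_of_set {0..1})) X (\<lambda>(w, t). g w t)"
proof (rule continuous_map_compact_open_eval)
  show "locally_compact_space (top_of_set {0..1::real})"
    by (intro compact_imp_locally_compact_space compact_space_subtopology)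
      (simp add: compactin_euclidean_iff)
  show "Hausdorff_space (top_of_set {0..1::real})"
    by (simp add: Hausdorff_space_subtopology)
qed (use assms in \<open>simp add: path_space_def\<close>)

lemma continuous_map_path_space_compose:
  assumes "continuous_map W (path_space X) g" "continuous_map X Z h"
  shows "continuous_map W (path_space Z) (\<lambda>w. restrict (h \<circ> g w) {0..1})"
proof (rule continuous_map_path_space_curry)
  show "continuous_map (prod_topology W (top_of_set {0..1})) Z (\<lambda>(w, t). (h \<circ> g w) t)"
    using continuous_map_compose [OF continuous_map_path_space_eval [OF assms(1)] assms(2)]
    by (simp add: o_def case_prod_unfold)
qed

text \<open>The library's \<^const>\<open>joinpaths\<close> is confined to types of class
  \<^class>\<open>topological_space\<close>.\<close>

definition concat_paths :: "(real \<Rightarrow> 'a) \<Rightarrow> (real \<Rightarrow> 'a) \<Rightarrow> real \<Rightarrow> 'a" where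
  "concat_paths a b = (\<lambda>t\<in>{0..1}. if t \<le> 1/2 then a (2 * t) else b (2 * t - 1))"

text \<open>After uncurrying, this is the pasting lemma on the two closed pieces
  \<open>t \<le> 1/2\<close> and \<open>t \<ge> 1/2\<close>, which agree at \<open>t = 1/2\<close>
  by \<open>ab\<close>.\<close>

lemma continuous_map_path_space_concat_paths:
  assumes a: "continuous_map W (path_space X) a" and b: "continuous_map W (path_space X) b"
    and ab: "\<And>w. w \<in> topspace W \<Longrightarrow> a w 1 = b w 0"
  shows "continuous_map W (path_space X) (\<lambda>w. concat_paths (a w) (b w))"
  unfolding concat_paths_def
proof (rule continuous_map_path_space_curry)
  let ?I = "top_of_set {0..1::real}"
  let ?WI = "prod_topology W ?I"
  have snd: "continuous_map ?WI euclideanreal snd"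
    using continuous_map_snd continuous_map_in_subtopology by blast
  \<comment> \<open>Both halves are affine reparametrisations: \<open>m = 2\<close> with
    \<open>k = 0\<close> or \<open>k = -1\<close>. \<open>T\<close> is the piece on which the new
    parameter stays in the unit interval.\<close>
  have reparam: "continuous_map (subtopology ?WI T) X (\<lambda>z. c (fst z) (m * snd z + k))"
    if c: "continuous_map W (path_space X) c"
      and T: "\<And>z. z \<in> topspace ?WI \<Longrightarrow> z \<in> T \<Longrightarrow> m * snd z + k \<in> {0..1}" for c T and m k :: real
  proof -
    have "continuous_map (subtopology ?WI T) ?WI (\<lambda>z. (fst z, m * snd z + k))"
      unfolding continuous_map_pairwise o_def fst_conv snd_conv
    proof
      show "continuous_map (subtopology ?WI T) W (\<lambda>z. fst z)"
        by (intro continuous_map_from_subtopology continuous_map_fst)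
      show "continuous_map (subtopology ?WI T) ?I (\<lambda>z. m * snd z + k)"
        using T
        by (intro continuous_map_into_subtopology continuous_map_from_subtopology
            continuous_intros snd) auto
    qed
    from continuous_map_compose [OF this continuous_map_path_space_eval [OF c]]
    show ?thesis
      by (simp add: o_def)
  qed
  have "continuous_map ?WI X
      (\<lambda>z. if snd z \<le> 1/2 then a (fst z) (2 * snd z + 0) else b (fst z) (2 * snd z + -1))"
    using ab by (intro continuous_map_cases_le snd reparam a b) (auto simp: field_simps)
  then show "continuous_map ?WI X (\<lambda>(w, t). if t \<le> 1/2 then a w (2 * t) else b w (2 * t - 1))"
    unfolding case_prod_unfold add_0_right diff_conv_add_uminus by simp
qed

section \<open>Sectional numbers under pullback\<close>

text \<open>Preimages under \<phi> preserve openness and inclusions and commute with differences. A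
  filtration for \<open>p\<close> thus pulls back to one of the same length, and \<open>lift\<close>
  supplies the sections over its differences.\<close>

lemma sec_le_pullback:
  assumes \<phi>: "continuous_map B' B \<phi>"
    and lift: "\<And>A s. \<lbrakk>continuous_map (subtopology B A) E s; \<forall>b\<in>A. p (s b) = b\<rbrakk>
      \<Longrightarrow> \<exists>s'. continuous_map (subtopology B' {b \<in> topspace B'. \<phi> b \<in> A}) E' s' \<and>
            (\<forall>b\<in>topspace B'. \<phi> b \<in> A \<longrightarrow> p' (s' b) = b)"
  shows "sec E' B' p' \<le> sec E B p"
proof -
  have "sec_filtration E' B' p' n (\<lambda>i. {b \<in> topspace B'. \<phi> b \<in> U i})"
    if U: "sec_filtration E B p n U" for n U
    unfolding sec_filtration_def
  proof (intro conjI allI ballI impI)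
    show "{b \<in> topspace B'. \<phi> b \<in> U 0} = {}"
      using U by (simp add: sec_filtration_def)
    show "{b \<in> topspace B'. \<phi> b \<in> U n} = topspace B'"
      using U continuous_map_funspace [OF \<phi>] by (auto simp: sec_filtration_def)
    show "openin B' {b \<in> topspace B'. \<phi> b \<in> U i}" if "i \<le> n" for i
      using U that by (intro openin_continuous_map_preimage [OF \<phi>]) (auto simp: sec_filtration_def)
    fix i
    assume i: "i \<in> {1..n}"
    then show "{b \<in> topspace B'. \<phi> b \<in> U (i - 1)} \<subseteq> {b \<in> topspace B'. \<phi> b \<in> U i}"
      using U unfolding sec_filtration_def by blast
    obtain s where "continuous_map (subtopology B (U i - U (i - 1))) E s"
      "\<forall>b \<in> U i - U (i - 1). p (s b) = b"
      using U i unfolding sec_filtration_def by blast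
    note lifted = lift [OF this]
    have diff: "{b \<in> topspace B'. \<phi> b \<in> U i} - {b \<in> topspace B'. \<phi> b \<in> U (i - 1)}
        = {b \<in> topspace B'. \<phi> b \<in> U i - U (i - 1)}"
      by blast
    from lifted
    show "\<exists>s. continuous_map (subtopology B'
            ({b \<in> topspace B'. \<phi> b \<in> U i} - {b \<in> topspace B'. \<phi> b \<in> U (i - 1)})) E' s \<and>
          (\<forall>b \<in> {b \<in> topspace B'. \<phi> b \<in> U i} - {b \<in> topspace B'. \<phi> b \<in> U (i - 1)}. p' (s b) = b)"
      unfolding diff by blast
  qed
  then show ?thesis
    unfolding sec_def by (intro Inf_superset_mono) blast
qed

section \<open>Invariance of the complexity under deformation retractions\<close>

theorem corollary3p7:
  fixes Xh :: "'a topology" and S :: "'a set" and Y :: "'b topology"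
    and v :: "'a \<Rightarrow> 'a" and f :: "'a \<Rightarrow> 'b"
  assumes "path_connected_space Xh" and "metric_ANR Xh"
    and "path_connected_space (subtopology Xh S)" and "metric_ANR (subtopology Xh S)"
    and "path_connected_space Y" and "metric_ANR Y"
    and "deformation_retraction Xh S v"
    and "continuous_map (subtopology Xh S) Y f"
    and "f ` topspace (subtopology Xh S) = topspace Y"
  shows "TC (subtopology Xh S) Y f = TC Xh Y (f \<circ> v)"
proof (rule antisym)
  let ?X = "subtopology Xh S"
  have v: "continuous_map Xh ?X v" and vS: "\<And>x. x \<in> S \<Longrightarrow> v x = x"
    and hom: "homotopic_with (\<lambda>_. True) Xh Xh id v"
    using assms(7) by (auto simp: deformation_retraction_def homotopic_with_sym)
  have incl: "continuous_map ?X Xh (\<lambda>x. x)"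
    by (intro continuous_map_from_subtopology) simp
  show "TC ?X Y f \<le> TC Xh Y (f \<circ> v)"
    unfolding TC_def
  proof (rule sec_le_pullback)
    show \<phi>: "continuous_map (prod_topology ?X Y) (prod_topology Xh Y) (\<lambda>b. b)"
      using continuous_map_into_fulltopology
      by (simp add: prod_topology_subtopology continuous_map_from_subtopology)
    fix A s
    assume s: "continuous_map (subtopology (prod_topology Xh Y) A) (path_space Xh) s"
      and sA: "\<forall>b\<in>A. (s b 0, (f \<circ> v) (s b 1)) = b"
    let ?A = "{b \<in> topspace (prod_topology ?X Y). b \<in> A}"
    have "continuous_map (subtopology (prod_topology ?X Y) ?A)
        (subtopology (prod_topology Xh Y) A) (\<lambda>b. b)"
      by (intro continuous_map_into_subtopology continuous_map_from_subtopology \<phi>) auto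
    from continuous_map_path_space_compose [OF continuous_map_compose [OF this s] v]
    have "continuous_map (subtopology (prod_topology ?X Y) ?A) (path_space ?X)
        (\<lambda>b. restrict (v \<circ> s b) {0..1})"
      by (simp add: o_def)
    \<comment> \<open>The start of the path is the first coordinate of \<open>b\<close>, which lies
      in \<open>S\<close> and is fixed by \<open>v\<close>. At the other end, \<open>sA\<close>
      already evaluates \<open>f \<circ> v\<close>.\<close>
    moreover have "(v (s b 0), f (v (s b 1))) = b"
      if "b \<in> topspace (prod_topology ?X Y)" "b \<in> A" for b
    proof -
      obtain x y where b: "b = (x, y)" by (cases b)
      then have "s b 0 = x" "f (v (s b 1)) = y"
        using sA that by auto
      then show ?thesis
        using that b vS by auto
    qed
    ultimately show "\<exists>s'. continuous_map (subtopology (prod_topology ?X Y) ?A) (path_space ?X) s' \<and>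
        (\<forall>b\<in>topspace (prod_topology ?X Y). b \<in> A \<longrightarrow> (s' b 0, f (s' b 1)) = b)"
      by (intro exI conjI) auto
  qed
  \<comment> \<open>\<open>hom\<close> reverses the given homotopy, so that the track of
    \<open>x\<close> starts at \<open>x\<close> and ends at \<open>v x\<close>.\<close>
  obtain H :: "real \<times> 'a \<Rightarrow> 'a"
    where H: "continuous_map (prod_topology (top_of_set {0..1}) Xh) Xh H"
    and H0: "\<forall>x. H (0, x) = x" and H1: "\<forall>x. H (1, x) = v x"
    using hom unfolding homotopic_with_def id_apply by blast
  let ?a = "\<lambda>x. restrict (\<lambda>t. H (t, x)) {0..1}"
  have a: "continuous_map Xh (path_space Xh) ?a"
  proof (rule continuous_map_path_space_curry)
    have "continuous_map (prod_topology Xh (top_of_set {0..1}))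
        (prod_topology (top_of_set {0..1}) Xh) (\<lambda>z. (snd z, fst z))"
      by (simp add: continuous_map_pairwise o_def continuous_map_fst continuous_map_snd)
    from continuous_map_compose [OF this H]
    show "continuous_map (prod_topology Xh (top_of_set {0..1})) Xh (\<lambda>(x, t). H (t, x))"
      by (simp add: o_def case_prod_unfold)
  qed
  let ?\<phi> = "\<lambda>b. (v (fst b), snd b)"
  show "TC Xh Y (f \<circ> v) \<le> TC ?X Y f"
    unfolding TC_def
  proof (rule sec_le_pullback)
    show \<phi>: "continuous_map (prod_topology Xh Y) (prod_topology ?X Y) ?\<phi>"
      using continuous_map_compose [OF continuous_map_fst v]
      by (simp add: continuous_map_pairwise o_def continuous_map_snd)
    fix A s
    assume s: "continuous_map (subtopology (prod_topology ?X Y) A) (path_space ?X) s"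
      and sA: "\<forall>b\<in>A. (s b 0, f (s b 1)) = b"
    let ?A = "{b \<in> topspace (prod_topology Xh Y). ?\<phi> b \<in> A}"
    let ?W = "subtopology (prod_topology Xh Y) ?A"
    \<comment> \<open>The path in the subspace, regarded as a path in \<open>Xh\<close> by composing
      with the inclusion.\<close>
    let ?b = "\<lambda>b. restrict (s (?\<phi> b)) {0..1}"
    have "continuous_map ?W (subtopology (prod_topology ?X Y) A) ?\<phi>"
      by (intro continuous_map_into_subtopology continuous_map_from_subtopology \<phi>) auto
    then have s\<phi>: "continuous_map ?W (path_space ?X) (\<lambda>b. s (?\<phi> b))"
      using continuous_map_compose [OF _ s] by (fastforce simp: o_def)
    then have b: "continuous_map ?W (path_space Xh) ?b"
      using continuous_map_path_space_compose [OF _ incl] by (fastforce simp: o_def)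
    have a': "continuous_map ?W (path_space Xh) (\<lambda>b. ?a (fst b))"
      using continuous_map_compose [OF continuous_map_from_subtopology [OF continuous_map_fst] a]
      by (simp add: o_def)
    have s0: "s (?\<phi> b) 0 = v (fst b)" and s1: "f (s (?\<phi> b) 1) = snd b" if "?\<phi> b \<in> A" for b
      using sA that by (metis fst_conv, metis snd_conv)
    \<comment> \<open>The path runs inside \<open>S\<close>, where \<open>v\<close> is the identity;
      hence \<open>f \<circ> v\<close> and \<open>f\<close> agree at its end.\<close>
    have vs1: "v (s (?\<phi> b) 1) = s (?\<phi> b) 1" if "b \<in> ?A" for b
    proof -
      have "s (?\<phi> b) 1 \<in> topspace ?X"
        using continuous_map_funspace [OF continuous_map_path_space_eval [OF s\<phi>]] that
        by (fastforce simp: Pi_iff)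
      then show ?thesis
        using vS by simp
    qed
    \<comment> \<open>The pieces match: the track of \<open>fst b\<close> ends at
      \<open>v (fst b)\<close>, which is where \<open>s (?\<phi> b)\<close> starts by
      \<open>s0\<close>.\<close>
    have "continuous_map ?W (path_space Xh) (\<lambda>b. concat_paths (?a (fst b)) (?b b))"
      using s0 H1 by (intro continuous_map_path_space_concat_paths a' b) auto
    moreover have "(concat_paths (?a (fst b)) (?b b) 0, (f \<circ> v) (concat_paths (?a (fst b)) (?b b) 1)) = b"
      if "b \<in> ?A" for b
      using that s1 vs1 [OF that] H0 by (simp add: concat_paths_def)
    ultimately show "\<exists>s'. continuous_map ?W (path_space Xh) s' \<and>
        (\<forall>b\<in>topspace (prod_topology Xh Y). ?\<phi> b \<in> A \<longrightarrow> (s' b 0, (f \<circ> v) (s' b 1)) = b)"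
      by (intro exI conjI) auto
  qed
qed

end
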